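(* Let $f:(0,\infty)\to\mathbb R$ be a convex function with $f(1)=0$. Let $\varepsilon>0$, $0<c<\mu_X(\mathcal X)^{-1}$, $d_c=1-c\,\mu_X(\mathcal X)$, and $\eta_{\mathrm{TV}}(\varepsilon)=\min\{(e^\varepsilon-1)/(1+e^\varepsilon d_c),1\}$. If the kernel $\mathsf K$ satisfies $\varepsilon$-PML on $\mathcal P_c$, then for any $P_X,Q_X\in\mathcal P_c$, $$D_f(P_X\mathsf K\|Q_X\mathsf K)\le\frac{\eta_{\mathrm{TV}}(\varepsilon)}{e^\varepsilon d_c}\Big[f(e^\varepsilon d_c+1)+(e^\varepsilon d_c+1)\,f\big((e^\varepsilon d_c+1)^{-1}\big)\Big]\,\mathrm{TV}(P_X\|Q_X).$$
   Context: Setting: $(\mathcal X,\Sigma_{\mathcal X})$ and $(\mathcal Y,\Sigma_{\mathcal Y})$ are standard Borel spaces, $\mu_X$ is a finite nonzero measure on $\mathcal X$, and $\mathcal P(\mathcal X)$ is the set of probability measures on $\mathcal X$ absolutely continuous w.r.t. $\mu_X$. A kernel $\mathsf K$ from $\mathcal X$ to $\mathcal Y$ assigns to each $x\in\mathcal X$ a probability measure $\mathsf K(\cdot|x)$ on $\mathcal Y$ (measurably in $x$), dominated by a $\sigma$-finite measure $\mu_Y$ on $\mathcal Y$. For a measure $\nu$ on $\mathcal X$, $(\nu\mathsf K)(B)=\int_{\mathcal X}\mathsf K(B|x)\,\nu(dx)$. Standing assumption on all kernels: for every $B\in\Sigma_{\mathcal Y}$, the supremum and infimum of $x\mapsto\mathsf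 K(B|x)$ equal its $\mu_X$-essential supremum and infimum. $\mathcal P_c=\{P\in\mathcal P(\mathcal X): dP/d\mu_X\ge c\}$. A kernel $\mathsf K$ satisfies $\varepsilon$-PML on $\mathcal P_c$ if $\mathsf K(B|x)\le e^\varepsilon (P\mathsf K)(B)$ for all $x\in\mathcal X$, $B\in\Sigma_{\mathcal Y}$, $P\in\mathcal P_c$. For $P\ll Q$, $D_f(P\|Q)=\int f(dP/dQ)\,dQ$. $\mathrm{TV}(P\|Q)=\sup_B|P(B)-Q(B)|$. *)

theory Defs
  imports "HOL-Probability.Probability"
begin

definition standard_borel :: "'a measure \<Rightarrow> bool" where
  "standard_borel M \<longleftrightarrow>
     (\<exists>T. completely_metrizable_space T \<and> second_countable T \<and> topspace T = space M \<and>
          sets M = sigma_sets (space M) {U. openin T U})"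

(* Order dual of the library's esssup. *)
definition essinf :: "'a measure \<Rightarrow>
    ('a \<Rightarrow> 'b::{second_countable_topology, dense_linorder, linorder_topology, complete_linorder}) \<Rightarrow> 'b"
  where "essinf M f = (if f \<in> borel_measurable M then Liminf (ae_filter M) f else bot)"

(* A kernel from X to Y is a measurable map K from X to prob_algebra Y, and the measure written
   \<nu>K is the monadic bind of \<nu> and K: see emeasure_bind for its value on measurable sets. *)

definition dominated_kernel :: "'a measure \<Rightarrow> 'b measure \<Rightarrow> ('a \<Rightarrow> 'b measure) \<Rightarrow> bool" where
  "dominated_kernel X \<mu>Y K \<longleftrightarrow> (\<forall>x\<in>space X. absolutely_continuous \<mu>Y (K x))"

definition sup_inf_essential :: "'a measure \<Rightarrow> 'b measure \<Rightarrow> ('a \<Rightarrow> 'b measure) \<Rightarrow> bool" where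
  "sup_inf_essential \<mu>X Y K \<longleftrightarrow>
     (\<forall>B\<in>sets Y. (SUP x\<in>space \<mu>X. emeasure (K x) B) = esssup \<mu>X (\<lambda>x. emeasure (K x) B) \<and>
                  (INF x\<in>space \<mu>X. emeasure (K x) B) = essinf \<mu>X (\<lambda>x. emeasure (K x) B))"

definition ac_prob_measures :: "'a measure \<Rightarrow> 'a measure set" where
  "ac_prob_measures \<mu>X = {P. prob_space P \<and> sets P = sets \<mu>X \<and> absolutely_continuous \<mu>X P}"

definition prob_measures_ge :: "'a measure \<Rightarrow> real \<Rightarrow> 'a measure set" where
  "prob_measures_ge \<mu>X c =
     {P \<in> ac_prob_measures \<mu>X. AE x in \<mu>X. ennreal c \<le> RN_deriv \<mu>X P x}"

definition satisfies_PML ::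
    "real \<Rightarrow> 'a measure set \<Rightarrow> 'a measure \<Rightarrow> 'b measure \<Rightarrow> ('a \<Rightarrow> 'b measure) \<Rightarrow> bool" where
  "satisfies_PML \<epsilon> \<P> X Y K \<longleftrightarrow>
     (\<forall>P\<in>\<P>. \<forall>x\<in>space X. \<forall>B\<in>sets Y. measure (K x) B \<le> exp \<epsilon> * measure (P \<bind> K) B)"

(* A real function on (0, \<infinity>) is extended to 0 by its right limit, possibly infinite, so that
   values outside the open half-line play no role. *)
definition extend_at_zero :: "(real \<Rightarrow> real) \<Rightarrow> real \<Rightarrow> ereal" where
  "extend_at_zero f t = (if t = 0 then Lim (at_right 0) (\<lambda>s. ereal (f s)) else ereal (f t))"

(* Extended-real integral as the difference of the integrals of positive and negative part, so
   that a divergent integral is not turned into 0; e2ennreal sends negative numbers to 0.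
   Meaningful only for P absolutely continuous with respect to Q, as RN_deriv is. *)
definition f_divergence :: "(real \<Rightarrow> real) \<Rightarrow> 'a measure \<Rightarrow> 'a measure \<Rightarrow> ereal" where
  "f_divergence f P Q =
     enn2ereal (\<integral>\<^sup>+y. e2ennreal (extend_at_zero f (enn2real (RN_deriv Q P y))) \<partial>Q) -
     enn2ereal (\<integral>\<^sup>+y. e2ennreal (- extend_at_zero f (enn2real (RN_deriv Q P y))) \<partial>Q)"

definition tv_dist :: "'a measure \<Rightarrow> 'a measure \<Rightarrow> real" where
  "tv_dist P Q = (SUP B\<in>sets P. \<bar>measure P B - measure Q B\<bar>)"

definition eta_TV :: "real \<Rightarrow> real \<Rightarrow> real" where
  "eta_TV \<epsilon> d = min ((exp \<epsilon> - 1) / (1 + exp \<epsilon> * d)) 1"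

end

theory Submission
  imports Defs
begin

text \<open>
  Put \<open>A = 1 + e\<^sup>\<epsilon> d\<close>. Writing \<open>P = c \<mu> + d \<nu>\<close> and using \<open>\<epsilon>\<close>-PML for \<open>Q\<close> gives
  \<open>PK - QK \<le> d sup K \<le> e\<^sup>\<epsilon> d QK\<close>, so the density of \<open>PK\<close> with respect to \<open>QK\<close> takes values in
  \<open>[1/A, A]\<close>. There the convex function \<open>f\<close> lies below the piecewise linear interpolation through
  \<open>1/A\<close>, \<open>1\<close> and \<open>A\<close>, whose integral is a multiple of \<open>TV(PK, QK)\<close>. Finally, applying PML to
  priors whose free part concentrates where \<open>K(B|\<cdot>)\<close> is nearly minimal, and to the complement of
  \<open>B\<close>, bounds the oscillation of \<open>K(B|\<cdot>)\<close> by \<open>\<eta>\<^sub>T\<^sub>V\<close>, which is then a contraction coefficient for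
  the total variation distance.
\<close>

section \<open>Total variation\<close>

text \<open>A supremum of reals bounds its members only if the set is bounded above; for probability
  measures every difference is at most 1.\<close>

lemma abs_measure_diff_le_tv_dist:
  assumes "prob_space P" "prob_space Q" "B \<in> sets P"
  shows "\<bar>measure P B - measure Q B\<bar> \<le> tv_dist P Q"
  unfolding tv_dist_def
proof (rule cSUP_upper[OF assms(3)])
  show "bdd_above ((\<lambda>B. \<bar>measure P B - measure Q B\<bar>) ` sets P)"
  proof (rule bdd_aboveI2)
    fix C
    show "\<bar>measure P C - measure Q C\<bar> \<le> 1"
      using prob_space.prob_le_1[OF assms(1), of C] prob_space.prob_le_1[OF assms(2), of C]
        measure_nonneg[of P C] measure_nonneg[of Q C] by linarith
  qed
qed

lemma tv_dist_least:
  assumes "\<And>B. B \<in> sets P \<Longrightarrow> \<bar>measure P B - measure Q B\<bar> \<le> C"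
  shows "tv_dist P Q \<le> C"
  unfolding tv_dist_def by (rule cSUP_least) (use assms in auto)

lemma tv_dist_commute: "sets P = sets Q \<Longrightarrow> tv_dist P Q = tv_dist Q P"
  by (simp add: tv_dist_def abs_minus_commute)

lemma measure_density_real:
  fixes p :: "'a \<Rightarrow> real"
  assumes "integrable M p" "\<And>x. x \<in> space M \<Longrightarrow> 0 \<le> p x" "B \<in> sets M"
  shows "measure (density M p) B = (\<integral>x. indicator B x * p x \<partial>M)"
proof -
  have "measure (density M p) B = (\<integral>x. indicator B x \<partial>density M p)"
    using assms(3) sets.sets_into_space[OF assms(3)] by (simp add: Int_absorb2)
  also have "\<dots> = (\<integral>x. p x *\<^sub>R indicator B x \<partial>M)"
    using assms by (intro integral_density) auto
  finally show ?thesis by (simp add: mult.commute)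
qed

text \<open>As \<open>p\<close> and \<open>q\<close> both integrate to 1, subtracting the infimum
  \<open>i\<close> of \<open>g\<close> leaves the difference of the integrals unchanged. Then
  \<open>g - i\<close> lies in the interval from 0 to \<open>\<eta>\<close>, so the difference is at
  most \<open>\<eta>\<close> times the integral of the positive part of \<open>p - q\<close>. That
  integral is the difference of the two measures on the set where \<open>q < p\<close>.\<close>

lemma integral_diff_le_oscillation_tv_dist:
  fixes p q g :: "'a \<Rightarrow> real"
  assumes p: "integrable M p" "\<And>x. x \<in> space M \<Longrightarrow> 0 \<le> p x" "(\<integral>x. p x \<partial>M) = 1"
    and q: "integrable M q" "\<And>x. x \<in> space M \<Longrightarrow> 0 \<le> q x" "(\<integral>x. q x \<partial>M) = 1"
    and g[measurable]: "g \<in> borel_measurable M"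
    and osc: "\<And>x x'. x \<in> space M \<Longrightarrow> x' \<in> space M \<Longrightarrow> g x - g x' \<le> \<eta>"
    and prob: "prob_space (density M p)" "prob_space (density M q)"
  shows "(\<integral>x. p x * g x \<partial>M) - (\<integral>x. q x * g x \<partial>M) \<le> \<eta> * tv_dist (density M p) (density M q)"
proof -
  have [measurable]: "p \<in> borel_measurable M" "q \<in> borel_measurable M" using p q by auto
  have ne: "space M \<noteq> {}"
    using prob_space.not_empty[OF prob(1)] by simp
  then obtain x0 where x0: "x0 \<in> space M" by auto
  have \<eta>: "0 \<le> \<eta>" using osc[OF x0 x0] by simp
  define i where "i = (INF x\<in>space M. g x)"
  have bb: "bdd_below (g ` space M)"
    using osc[OF x0] by (intro bdd_belowI2[where m="g x0 - \<eta>"]) (simp add: algebra_simps)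
  have i_le: "i \<le> g x" if "x \<in> space M" for x
    unfolding i_def by (rule cINF_lower[OF bb that])
  have le_i: "g x - \<eta> \<le> i" if "x \<in> space M" for x
    unfolding i_def using osc[OF that] by (intro cINF_greatest[OF ne]) (simp add: algebra_simps)
  \<comment> \<open>The oscillation bound makes \<open>g - i\<close> bounded by
    \<open>\<eta>\<close>, so it may be multiplied by any integrable function.\<close>
  have bnd: "integrable M (\<lambda>x. r x * (g x - i))" if r: "integrable M r" for r :: "'a \<Rightarrow> real"
  proof (rule Bochner_Integration.integrable_bound[OF integrable_mult_left[OF r, of \<eta>]])
    show "AE x in M. norm (r x * (g x - i)) \<le> norm (r x * \<eta>)"
    proof (rule AE_I2)
      fix x assume "x \<in> space M"
      then have "\<bar>g x - i\<bar> \<le> \<bar>\<eta>\<bar>" using i_le[of x] le_i[of x] by auto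
      then show "norm (r x * (g x - i)) \<le> norm (r x * \<eta>)"
        by (simp add: abs_mult mult_left_mono)
    qed
  qed (use r in measurable)
  have shift: "(\<integral>x. r x * g x \<partial>M) = (\<integral>x. r x * (g x - i) \<partial>M) + i * (\<integral>x. r x \<partial>M)"
    if r: "integrable M r" for r :: "'a \<Rightarrow> real"
  proof -
    have "(\<integral>x. r x * g x \<partial>M) = (\<integral>x. r x * (g x - i) + i * r x \<partial>M)"
      by (rule Bochner_Integration.integral_cong) (auto simp: algebra_simps)
    also have "\<dots> = (\<integral>x. r x * (g x - i) \<partial>M) + i * (\<integral>x. r x \<partial>M)"
      using bnd[OF r] r by simp
    finally show ?thesis .
  qed
  \<comment> \<open>The positive set of a Hahn decomposition for the difference of the two
    measures.\<close>
  define S where "S = {x \<in> space M. q x < p x}"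
  have S[measurable]: "S \<in> sets M" unfolding S_def by measurable
  have intS: "integrable M (\<lambda>x. indicator S x * p x)" "integrable M (\<lambda>x. indicator S x * q x)"
    using p(1) q(1) integrable_real_mult_indicator[OF S] by (auto simp: mult.commute)
  have "(\<integral>x. p x * g x \<partial>M) - (\<integral>x. q x * g x \<partial>M)
      = (\<integral>x. p x * (g x - i) - q x * (g x - i) \<partial>M)"
    using shift[OF p(1)] shift[OF q(1)] p(3) q(3) bnd[OF p(1)] bnd[OF q(1)] by simp
  also have "\<dots> \<le> (\<integral>x. \<eta> * (indicator S x * p x - indicator S x * q x) \<partial>M)"
  proof (rule integral_mono)
    fix x assume x: "x \<in> space M"
    show "p x * (g x - i) - q x * (g x - i) \<le> \<eta> * (indicator S x * p x - indicator S x * q x)"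
    proof (cases "x \<in> S")
      case True
      then have "(p x - q x) * (g x - i) \<le> (p x - q x) * \<eta>"
        using le_i[OF x] by (intro mult_left_mono) (auto simp: S_def)
      then show ?thesis using True by (simp add: algebra_simps)
    next
      case False
      then have "(q x - p x) * (g x - i) \<ge> 0"
        using x i_le[OF x] by (intro mult_nonneg_nonneg) (auto simp: S_def)
      then show ?thesis using False by (simp add: algebra_simps)
    qed
  qed (use bnd[OF p(1)] bnd[OF q(1)] intS in auto)
  also have "\<dots> = \<eta> * (measure (density M p) S - measure (density M q) S)"
    using intS p q S by (simp add: measure_density_real)
  also have "\<dots> \<le> \<eta> * tv_dist (density M p) (density M q)"
    using abs_measure_diff_le_tv_dist[OF prob, of S] \<eta> S by (intro mult_left_mono) auto
  finally show ?thesis .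
qed

section \<open>Divergence of measures with bounded density ratio\<close>

text \<open>On each of the intervals from 1 to \<open>A\<close> and from \<open>1 / A\<close> to 1,
  \<open>f\<close> lies below its chord, and both chords vanish at 1. Multiplying numerator and
  denominator of the left chord's slope by \<open>A\<close> gives both the denominator
  \<open>A - 1\<close>.\<close>

lemma convex_le_chords_through_one:
  fixes f :: "real \<Rightarrow> real"
  assumes f: "convex_on {0<..} f" "f 1 = 0" and A: "1 < A" and t: "1 / A \<le> t" "t \<le> A"
  shows "f t \<le> (f A * max (t - 1) 0 + A * f (1 / A) * max (1 - t) 0) / (A - 1)"
proof (cases "1 \<le> t")
  case True
  have "convex_on {1..A} f" by (rule convex_on_subset[OF f(1)]) auto
  from convex_onD_Icc'[OF this, of t] show ?thesis using True t f A
    by (simp add: max_def field_simps)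
next
  case False
  have "convex_on {1/A..1} f" using A by (intro convex_on_subset[OF f(1)])
      (auto intro: less_le_trans[of 0 "1/A"])
  from convex_onD_Icc''[OF this, of t] have "f t \<le> f (1/A) / (1 - 1/A) * (1 - t)"
    using False t f by simp
  also have "f (1/A) / (1 - 1/A) = A * f (1/A) / (A - 1)" using A by (simp add: field_simps)
  finally show ?thesis using False by (simp add: max_def)
qed

text \<open>The point \<open>1\<close> is the convex combination of \<open>A\<close> and \<open>1/A\<close> with weights \<open>1/(A+1)\<close> and
  \<open>A/(A+1)\<close>; neither summand below need be nonnegative by itself.\<close>

lemma convex_chord_slopes_nonneg:
  fixes f :: "real \<Rightarrow> real"
  assumes f: "convex_on {0<..} f" "f 1 = 0" and A: "0 < A"
  shows "0 \<le> f A + A * f (1 / A)"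
proof -
  have "f ((1 - A/(A+1)) *\<^sub>R A + (A/(A+1)) *\<^sub>R (1/A))
      \<le> (1 - A/(A+1)) * f A + A/(A+1) * f (1/A)"
    by (rule convex_onD[OF f(1)]) (use A in auto)
  moreover have "(1 - A/(A+1)) *\<^sub>R A + (A/(A+1)) *\<^sub>R (1/A) = 1"
  proof -
    have "1 - A/(A+1) = 1/(A+1)" using A by (simp add: field_simps)
    moreover have "1/(A+1) * A + A/(A+1) * (1/A) = (A + 1)/(A + 1)"
      using A by (simp add: add_divide_distrib[symmetric])
    ultimately show ?thesis using A by simp
  qed
  moreover have "1 - A/(A+1) = 1/(A+1)" using A by (simp add: field_simps)
  ultimately have "0 \<le> 1/(A+1) * f A + A/(A+1) * f (1/A)" using f(2) by simp
  also have "\<dots> = (f A + A * f (1/A)) / (A + 1)" by (simp add: add_divide_distrib)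
  finally show ?thesis using A by (simp add: zero_le_divide_iff)
qed

text \<open>The two setwise bounds confine the density \<open>r\<close> to the interval from
  \<open>1 / A\<close> to \<open>A\<close>, where the chord bound applies. Integrating it produces
  the positive and negative parts of \<open>r - 1\<close>, which have the same integral
  \<open>T\<close>, and \<open>T\<close> is at most the total variation distance.\<close>

lemma f_divergence_le_tv_dist:
  fixes f :: "real \<Rightarrow> real"
  assumes "prob_space P" "prob_space Q" and sets: "sets P = sets Q"
    and f: "convex_on {0<..} f" "f 1 = 0" and A: "1 < A"
    and PQ: "\<And>B. B \<in> sets Q \<Longrightarrow> measure P B \<le> A * measure Q B"
    and QP: "\<And>B. B \<in> sets Q \<Longrightarrow> measure Q B \<le> A * measure P B"
  shows "f_divergence f P Q \<le> ereal ((f A + A * f (1 / A)) / (A - 1) * tv_dist P Q)"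
proof -
  interpret P: prob_space P by fact
  interpret Q: prob_space Q by fact
  have ac: "absolutely_continuous Q P"
    unfolding absolutely_continuous_def
  proof
    fix B assume B: "B \<in> null_sets Q"
    then have "measure P B \<le> 0" using PQ[of B] by (auto simp: Q.emeasure_eq_measure null_sets_def)
    then show "B \<in> null_sets P" using B sets measure_nonneg[of P B]
      by (auto simp: P.emeasure_eq_measure null_sets_def simp del: measure_nonneg)
  qed
  define r where "r y = enn2real (RN_deriv Q P y)" for y
  have r[measurable]: "r \<in> borel_measurable Q" unfolding r_def by measurable
  have r0: "0 \<le> r y" for y by (simp add: r_def)
  note RNi = Q.RN_deriv_integrable[OF P.sigma_finite_measure_axioms ac sets, folded r_def]
  note RNe = Q.RN_deriv_integral[OF P.sigma_finite_measure_axioms ac sets, folded r_def]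
  have ir: "integrable Q r" using RNi[of "\<lambda>_. 1"] by simp
  have int_r: "(\<integral>y. r y \<partial>Q) = 1" using RNe[of "\<lambda>_. 1"] by (simp add: P.prob_space)
  have Pm: "measure P B = (\<integral>y. indicator B y * r y \<partial>Q)" if "B \<in> sets Q" for B
    using RNe[of "indicator B"] that sets sets.sets_into_space[of B P]
    by (simp add: Int_absorb2 mult.commute)
  have iB: "integrable Q (\<lambda>y. indicator B y * r y)" if "B \<in> sets Q" for B
    using integrable_real_mult_indicator[OF that ir] by (simp add: mult.commute)
  have iI: "integrable Q (indicator B :: _ \<Rightarrow> real)" if "B \<in> sets Q" for B
    using that by (simp add: Q.emeasure_eq_measure)
  \<comment> \<open>An integrable function whose integral over every measurable set is nonnegative
    is nonnegative almost everywhere; this turns the setwise bounds into pointwise ones.\<close>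
  have AE1: "AE y in Q. 0 \<le> A - r y"
  proof (rule Q.density_nonneg)
    fix B assume B: "B \<in> sets Q"
    have "set_lebesgue_integral Q B (\<lambda>y. A - r y)
        = (\<integral>y. A * indicator B y - indicator B y * r y \<partial>Q)"
      unfolding set_lebesgue_integral_def
      by (rule Bochner_Integration.integral_cong) (auto simp: algebra_simps)
    also have "\<dots> = A * measure Q B - measure P B"
      using B iB[OF B] iI[OF B] sets.sets_into_space[of B Q] by (simp add: Pm Int_absorb2)
    finally show "0 \<le> set_lebesgue_integral Q B (\<lambda>y. A - r y)" using PQ[OF B] by simp
  qed (use ir in simp)
  have AE2: "AE y in Q. 0 \<le> A * r y - 1"
  proof (rule Q.density_nonneg)
    fix B assume B: "B \<in> sets Q"
    have "set_lebesgue_integral Q B (\<lambda>y. A * r y - 1)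
        = (\<integral>y. A * (indicator B y * r y) - indicator B y \<partial>Q)"
      unfolding set_lebesgue_integral_def
      by (rule Bochner_Integration.integral_cong) (auto simp: algebra_simps)
    also have "\<dots> = A * measure P B - measure Q B"
      using B iB[OF B] iI[OF B] sets.sets_into_space[of B Q] by (simp add: Pm Int_absorb2)
    finally show "0 \<le> set_lebesgue_integral Q B (\<lambda>y. A * r y - 1)" using QP[OF B] by simp
  qed (use ir in simp)
  have AEr: "AE y in Q. 1 / A \<le> r y \<and> r y \<le> A"
    using AE1 AE2 by eventually_elim (use A in \<open>auto simp: field_simps\<close>)
  \<comment> \<open>Clipping the argument makes \<open>h\<close> bounded and measurable everywhere,
    although nothing is known about \<open>f\<close> outside the open half-line; almost everywhere
    \<open>h y = f (r y)\<close>.\<close>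
  define clip where "clip t = max (1 / A) (min A t)" for t
  have A1: "1 / A \<le> A" "0 < 1 / A" using A by (auto simp: field_simps less_1_mult less_imp_le)
  have clip: "clip t \<in> {1/A..A}" for t using A1 by (auto simp: clip_def)
  define h where "h y = f (clip (r y))" for y
  \<comment> \<open>A convex function is continuous on an open interval, and the compact interval
    stays away from 0.\<close>
  have contf: "continuous_on {1/A..A} f"
    by (rule continuous_on_subset[OF convex_on_continuous[OF _ f(1)]])
      (use A1 in \<open>auto intro: less_le_trans[of 0 "1 / A"] simp del: zero_less_divide_1_iff\<close>)
  have "continuous_on UNIV (\<lambda>t. f (clip t))"
  proof (rule continuous_on_compose2[OF contf])
    show "continuous_on UNIV clip" unfolding clip_def by (intro continuous_intros)
  qed (use clip in auto)
  then have h[measurable]: "h \<in> borel_measurable Q"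
    unfolding h_def using borel_measurable_continuous_on r by blast
  have "bounded (f ` {1/A..A})" by (intro compact_imp_bounded compact_continuous_image contf) simp
  then obtain b where b: "\<And>t. t \<in> {1/A..A} \<Longrightarrow> \<bar>f t\<bar> \<le> b"
    unfolding bounded_iff by (metis image_eqI real_norm_def)
  have ih: "integrable Q h"
    by (rule Q.integrable_const_bound[where B=b]) (use b clip in \<open>auto simp: h_def\<close>)
  have ext: "AE y in Q. extend_at_zero f (r y) = ereal (h y)"
    using AEr
  proof eventually_elim
    case (elim y)
    then have "clip (r y) = r y" by (auto simp: clip_def)
    moreover have "r y \<noteq> 0" using elim A1 by auto
    ultimately show ?case by (simp add: extend_at_zero_def h_def)
  qed
  have pos: "(\<integral>\<^sup>+y. e2ennreal (extend_at_zero f (r y)) \<partial>Q) = (\<integral>\<^sup>+y. ennreal (h y) \<partial>Q)"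
    using ext by (intro nn_integral_cong_AE) (auto elim: eventually_mono)
  have neg: "(\<integral>\<^sup>+y. e2ennreal (- extend_at_zero f (r y)) \<partial>Q) = (\<integral>\<^sup>+y. ennreal (- h y) \<partial>Q)"
    using ext by (intro nn_integral_cong_AE) (auto elim: eventually_mono)
  \<comment> \<open>With both parts finite, the extended-real difference in
    \<open>f_divergence\<close> is an ordinary integral.\<close>
  have fin: "(\<integral>\<^sup>+y. ennreal (h y) \<partial>Q) \<noteq> \<infinity>" "(\<integral>\<^sup>+y. ennreal (- h y) \<partial>Q) \<noteq> \<infinity>"
    using ih by (auto simp: real_integrable_def)
  have enn: "enn2ereal z = ereal (enn2real z)" if "z \<noteq> \<infinity>" for z :: ennreal
    using that by (cases z) (auto simp: enn2ereal_ennreal)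
  have D: "f_divergence f P Q = ereal (\<integral>y. h y \<partial>Q)"
    unfolding f_divergence_def r_def[symmetric] pos neg
    using fin by (simp add: real_lebesgue_integral_def[OF ih] enn)
  define S where "S = {y \<in> space Q. 1 < r y}"
  have S[measurable]: "S \<in> sets Q" unfolding S_def by measurable
  have imax: "integrable Q (\<lambda>y. max (r y - 1) 0)" "integrable Q (\<lambda>y. max (1 - r y) 0)"
    using ir by auto
  define T where "T = (\<integral>y. max (r y - 1) 0 \<partial>Q)"
  \<comment> \<open>The two parts differ by the integral of \<open>r - 1\<close>, which is 0 because
    \<open>P\<close> and \<open>Q\<close> have equal mass.\<close>
  have T': "(\<integral>y. max (1 - r y) 0 \<partial>Q) = T"
  proof -
    have "T - (\<integral>y. max (1 - r y) 0 \<partial>Q) = (\<integral>y. max (r y - 1) 0 - max (1 - r y) 0 \<partial>Q)"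
      unfolding T_def using imax by simp
    also have "\<dots> = (\<integral>y. r y - 1 \<partial>Q)"
      by (rule Bochner_Integration.integral_cong) auto
    also have "\<dots> = 0" using ir int_r by (simp add: Q.prob_space)
    finally show ?thesis by simp
  qed
  have "T = (\<integral>y. indicator S y * r y - indicator S y \<partial>Q)"
    unfolding T_def by (rule Bochner_Integration.integral_cong) (auto simp: S_def indicator_def)
  also have "\<dots> = measure P S - measure Q S"
    using iB[OF S] iI[OF S] sets.sets_into_space[OF S] S by (simp add: Pm Int_absorb2)
  also have "\<dots> \<le> tv_dist P Q"
    using abs_measure_diff_le_tv_dist[OF assms(1,2), of S] S sets by simp
  finally have T: "T \<le> tv_dist P Q" .
  have "(\<integral>y. h y \<partial>Q)
      \<le> (\<integral>y. (f A * max (r y - 1) 0 + A * f (1 / A) * max (1 - r y) 0) / (A - 1) \<partial>Q)"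
  proof (rule integral_mono_AE[OF ih])
    show "AE y in Q. h y \<le> (f A * max (r y - 1) 0 + A * f (1 / A) * max (1 - r y) 0) / (A - 1)"
      using AEr
    proof eventually_elim
      case (elim y)
      then have "clip (r y) = r y" by (auto simp: clip_def)
      then show ?case unfolding h_def using convex_le_chords_through_one[OF f A] elim by simp
    qed
  qed (use imax in auto)
  also have "\<dots> = (f A + A * f (1 / A)) / (A - 1) * T"
    using imax T' by (simp add: T_def[symmetric] algebra_simps add_divide_distrib)
  \<comment> \<open>Replacing \<open>T\<close> by the larger distance requires the combined
    coefficient to be nonnegative, which is the convexity inequality at 1.\<close>
  also have "\<dots> \<le> (f A + A * f (1 / A)) / (A - 1) * tv_dist P Q"
    using convex_chord_slopes_nonneg[OF f, of A] A T by (intro mult_left_mono) auto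
  finally show ?thesis by (simp add: D)
qed

section \<open>Priors with density bounded below\<close>

text \<open>Taking the maximum of the Radon-Nikodym derivative with \<open>c\<close> changes it only
  on a null set. This yields a real density that is at least \<open>c\<close> everywhere rather than
  almost everywhere.\<close>

lemma prob_measures_geE:
  assumes "finite_measure M" "0 \<le> c" "P \<in> prob_measures_ge M c"
  obtains p :: "'a \<Rightarrow> real" where "integrable M p" "\<And>x. c \<le> p x" "(\<integral>x. p x \<partial>M) = 1"
    "P = density M p" "prob_space P"
proof -
  interpret finite_measure M by fact
  from assms(3) have P: "prob_space P" "sets P = sets M" "absolutely_continuous M P"
    and AEc: "AE x in M. ennreal c \<le> RN_deriv M P x"
    by (auto simp: prob_measures_ge_def ac_prob_measures_def)
  interpret P: prob_space P by fact
  define p where "p x = max c (enn2real (RN_deriv M P x))" for x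
  have [measurable]: "p \<in> borel_measurable M" unfolding p_def by measurable
  have AEp: "AE x in M. RN_deriv M P x = ennreal (p x)"
    using AEc RN_deriv_finite[OF P.sigma_finite_measure_axioms P(3,2)]
  proof eventually_elim
    case (elim x)
    then show ?case using assms(2) by (cases "RN_deriv M P x") (auto simp: p_def)
  qed
  have "P = density M (RN_deriv M P)" using density_RN_deriv[OF P(3,2)] by simp
  also have "\<dots> = density M p" by (rule density_cong) (use AEp in auto)
  finally have Peq: "P = density M p" .
  have p0: "0 \<le> p x" for x using assms(2) by (auto simp: p_def)
  have "(\<integral>\<^sup>+x. ennreal (p x) \<partial>M) = emeasure P (space P)"
    by (subst (1 2) Peq) (simp add: emeasure_density cong: nn_integral_cong)
  then have "(\<integral>\<^sup>+x. ennreal (p x) \<partial>M) = ennreal 1" by (simp add: P.emeasure_space_1)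
  then have "has_bochner_integral M p 1"
    by (intro has_bochner_integral_nn_integral) (auto simp: p0)
  then show ?thesis
    using Peq P(1) by (intro that[of p]) (auto simp: has_bochner_integral_iff, simp add: p_def)
qed

text \<open>This converse makes it possible to exhibit explicit priors; uniqueness of the
  Radon-Nikodym derivative transfers the pointwise bound.\<close>

lemma density_in_prob_measures_ge:
  fixes p :: "'a \<Rightarrow> real"
  assumes "finite_measure M" "0 \<le> c" and p: "integrable M p" "\<And>x. c \<le> p x" "(\<integral>x. p x \<partial>M) = 1"
  shows "density M p \<in> prob_measures_ge M c"
proof -
  interpret finite_measure M by fact
  have [measurable]: "p \<in> borel_measurable M" using p by auto
  have p0: "0 \<le> p x" for x using p(2)[of x] assms(2) by simp
  have "prob_space (density M p)"
    by (rule prob_spaceI)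
      (use p p0 in \<open>simp add: emeasure_density nn_integral_eq_integral cong: nn_integral_cong\<close>)
  moreover have "AE x in M. ennreal (p x) = RN_deriv M (density M p) x"
    by (rule RN_deriv_unique) auto
  then have "AE x in M. ennreal c \<le> RN_deriv M (density M p) x"
    by eventually_elim (metis ennreal_leI p(2))
  ultimately show ?thesis
    by (auto simp: prob_measures_ge_def ac_prob_measures_def intro!: absolutely_continuousI_density)
qed

section \<open>Kernels satisfying PML\<close>

text \<open>The number \<open>d\<close> is the free mass of a prior: if a probability density
  \<open>p\<close> is at least \<open>c\<close>, then \<open>p - c\<close> integrates to
  \<open>d\<close>.\<close>

locale PML_kernel = finite_measure M
  for M :: "'a measure" +
  fixes Y :: "'b measure" and K :: "'a \<Rightarrow> 'b measure" and \<epsilon> c d :: real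
  assumes kernel[measurable]: "K \<in> M \<rightarrow>\<^sub>M prob_algebra Y"
    and ess: "sup_inf_essential M Y K"
    and PML: "satisfies_PML \<epsilon> (prob_measures_ge M c) M Y K"
    and c_pos: "0 < c" and d_pos: "0 < d" and d_eq: "d = 1 - c * measure M (space M)"
begin

lemma kernel_prob: "x \<in> space M \<Longrightarrow> prob_space (K x)" "x \<in> space M \<Longrightarrow> sets (K x) = sets Y"
  using measurable_space[OF kernel] by (auto simp: space_prob_algebra)

lemma kernel_measurable: "B \<in> sets Y \<Longrightarrow> (\<lambda>x. measure (K x) B) \<in> borel_measurable M"
  using measurable_compose[OF kernel measurable_measure_prob_algebra] .

lemma integrable_mult_kernel:
  assumes "integrable M r" "B \<in> sets Y"
  shows "integrable M (\<lambda>x. r x * measure (K x) B)"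
proof (rule Bochner_Integration.integrable_bound[OF assms(1)])
  show "(\<lambda>x. r x * measure (K x) B) \<in> borel_measurable M"
    using assms(1) kernel_measurable[OF assms(2)] by measurable
  show "AE x in M. norm (r x * measure (K x) B) \<le> norm (r x)"
    using prob_space.prob_le_1[OF kernel_prob(1)]
    by (intro AE_I2) (auto simp: abs_mult intro!: mult_left_le)
qed

lemma measure_density_bind:
  fixes p :: "'a \<Rightarrow> real"
  assumes p: "integrable M p" "\<And>x. 0 \<le> p x" "prob_space (density M p)" and B: "B \<in> sets Y"
  shows "measure (density M p \<bind> K) B = (\<integral>x. p x * measure (K x) B \<partial>M)"
proof -
  interpret P: prob_space "density M p" by fact
  interpret P: subprob_space "density M p" by (rule prob_space_imp_subprob_space) fact
  have "K \<in> density M p \<rightarrow>\<^sub>M subprob_algebra Y"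
    using measurable_prob_algebraD[OF kernel] by simp
  then have "measure (density M p \<bind> K) B = (\<integral>x. measure (K x) B \<partial>density M p)"
    using B by (rule P.measure_bind)
  also have "\<dots> = (\<integral>x. p x *\<^sub>R measure (K x) B \<partial>M)"
    using p kernel_measurable[OF B] by (intro integral_density) auto
  finally show ?thesis by simp
qed

lemma bind_prob:
  assumes "prob_space P" "sets P = sets M"
  shows "prob_space (P \<bind> K)" "sets (P \<bind> K) = sets Y"
proof -
  have "P \<in> space (prob_algebra M)" using assms by (simp add: space_prob_algebra)
  then show "prob_space (P \<bind> K)" "sets (P \<bind> K) = sets Y"
    using prob_space_bind' sets_bind' kernel by metis+
qed

lemma kernel_le:
  fixes p :: "'a \<Rightarrow> real"
  assumes p: "integrable M p" "\<And>x. c \<le> p x" "(\<integral>x. p x \<partial>M) = 1"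
    and x: "x \<in> space M" and B: "B \<in> sets Y"
  shows "measure (K x) B \<le> exp \<epsilon> * (\<integral>x. p x * measure (K x) B \<partial>M)"
proof -
  have mem: "density M p \<in> prob_measures_ge M c"
    using density_in_prob_measures_ge[OF finite_measure_axioms _ p] c_pos by simp
  then have "prob_space (density M p)" by (simp add: prob_measures_ge_def ac_prob_measures_def)
  moreover have "0 \<le> p x" for x using p(2)[of x] c_pos by simp
  ultimately show ?thesis
    using PML mem x B measure_density_bind[OF p(1)] unfolding satisfies_PML_def by metis
qed

section \<open>Density ratio of the output distributions\<close>

text \<open>Since \<open>q\<close> is at least \<open>c\<close>, the integrand of the difference is
  at most \<open>p - c\<close> times the kernel. PML for \<open>Q\<close> bounds the kernel
  uniformly by \<open>exp \<epsilon>\<close> times the output probability under \<open>Q\<close>,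
  and \<open>p - c\<close> has mass \<open>d\<close>.\<close>

lemma bind_ratio_le:
  assumes P: "P \<in> prob_measures_ge M c" and Q: "Q \<in> prob_measures_ge M c" and B: "B \<in> sets Y"
  shows "measure (P \<bind> K) B \<le> (exp \<epsilon> * d + 1) * measure (Q \<bind> K) B"
proof -
  obtain p where p: "integrable M p" "\<And>x. c \<le> p x" "(\<integral>x. p x \<partial>M) = 1"
      "P = density M p" "prob_space P"
    using prob_measures_geE[OF finite_measure_axioms _ P] c_pos by (metis less_imp_le)
  obtain q where q: "integrable M q" "\<And>x. c \<le> q x" "(\<integral>x. q x \<partial>M) = 1"
      "Q = density M q" "prob_space Q"
    using prob_measures_geE[OF finite_measure_axioms _ Q] c_pos by (metis less_imp_le)
  have p0: "0 \<le> p x" and q0: "0 \<le> q x" for x using p(2)[of x] q(2)[of x] c_pos by auto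
  have Pm: "measure (P \<bind> K) B = (\<integral>x. p x * measure (K x) B \<partial>M)"
    using measure_density_bind[OF p(1) p0 _ B] p by simp
  have Qm: "measure (Q \<bind> K) B = (\<integral>x. q x * measure (K x) B \<partial>M)"
    using measure_density_bind[OF q(1) q0 _ B] q by simp
  let ?s = "exp \<epsilon> * measure (Q \<bind> K) B"
  have "measure (P \<bind> K) B - measure (Q \<bind> K) B
      = (\<integral>x. p x * measure (K x) B - q x * measure (K x) B \<partial>M)"
    unfolding Pm Qm using integrable_mult_kernel p q B by simp
  also have "\<dots> \<le> (\<integral>x. (p x - c) * ?s \<partial>M)"
  proof (rule integral_mono)
    fix x assume x: "x \<in> space M"
    have "p x * measure (K x) B - q x * measure (K x) B \<le> (p x - c) * measure (K x) B"
      using mult_right_mono[OF q(2)[of x], of "measure (K x) B"] by (simp add: algebra_simps)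
    also have "\<dots> \<le> (p x - c) * ?s"
      using kernel_le[OF q(1-3) x B] p(2)[of x] unfolding Qm by (intro mult_left_mono) auto
    finally show "p x * measure (K x) B - q x * measure (K x) B \<le> (p x - c) * ?s" .
  qed (use integrable_mult_kernel p q B in auto)
  also have "\<dots> = d * ?s" using p by (simp add: d_eq)
  finally show ?thesis by (simp add: algebra_simps)
qed

section \<open>Oscillation of the kernel and contraction of total variation\<close>

text \<open>This is PML for the limiting prior \<open>c\<close> times \<open>M\<close> plus a point
  mass \<open>d\<close> at \<open>x'\<close>. Such a prior need not have a density, so the point
  mass is spread over a set where the kernel is at most slightly larger than at
  \<open>x'\<close>.\<close>

lemma kernel_le_kernel:
  assumes x: "x \<in> space M" and x': "x' \<in> space M" and B: "B \<in> sets Y"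
  shows "measure (K x) B \<le> exp \<epsilon> * (c * (\<integral>x. measure (K x) B \<partial>M) + d * measure (K x') B)"
proof (rule field_le_epsilon)
  fix e :: real assume e: "0 < e"
  \<comment> \<open>Chosen so that \<open>exp \<epsilon> * d * \<delta> = e\<close>, the final
    error.\<close>
  define \<delta> where "\<delta> = e / (exp \<epsilon> * d)"
  have \<delta>: "0 < \<delta>" using e d_pos by (simp add: \<delta>_def)
  let ?g = "\<lambda>x. measure (K x) B"
  note gm[measurable] = kernel_measurable[OF B]
  define S where "S = {x \<in> space M. ?g x < ?g x' + \<delta>}"
  have S[measurable]: "S \<in> sets M" unfolding S_def by measurable
  have eg: "emeasure (K x) B = ennreal (?g x)" if "x \<in> space M" for x
    using kernel_prob(1)[OF that]
    by (simp add: finite_measure.emeasure_eq_measure prob_space.finite_measure)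
  \<comment> \<open>If \<open>S\<close> were null, the essential infimum would be at least the value
    at \<open>x'\<close> plus \<open>\<delta>\<close>. But it equals the infimum, which is at most
    the value at \<open>x'\<close>.\<close>
  have "measure M S \<noteq> 0"
  proof
    assume 0: "measure M S = 0"
    then have "S \<in> null_sets M" using S by (auto simp: emeasure_eq_measure)
    then have "AE x in M. x \<notin> S" by (rule AE_not_in)
    then have "AE x in M. ennreal (?g x' + \<delta>) \<le> emeasure (K x) B"
      using AE_space by eventually_elim (auto simp: S_def eg intro!: ennreal_leI)
    then have "ennreal (?g x' + \<delta>) \<le> Liminf (ae_filter M) (\<lambda>x. emeasure (K x) B)"
      by (rule Liminf_bounded)
    also have "\<dots> = essinf M (\<lambda>x. emeasure (K x) B)"
      using measurable_compose[OF measurable_prob_algebraD[OF kernel]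
          measurable_emeasure_subprob_algebra[OF B]] by (simp add: essinf_def)
    also have "\<dots> = (INF x\<in>space M. emeasure (K x) B)"
      using ess B by (simp add: sup_inf_essential_def)
    also have "\<dots> \<le> ennreal (?g x')" using x' unfolding eg[OF x', symmetric] by (rule INF_lower)
    finally show False using \<delta> by (simp add: ennreal_le_iff)
  qed
  then have mS: "0 < measure M S" by (simp add: zero_less_measure_iff)
  \<comment> \<open>The lower bound \<open>c\<close> everywhere, with the free mass \<open>d\<close>
    spread uniformly over \<open>S\<close>.\<close>
  define p where "p x = c + d / measure M S * indicator S x" for x
  have iS: "integrable M (indicator S :: 'a \<Rightarrow> real)" by (simp add: emeasure_eq_measure)
  have S_sub: "S \<inter> space M = S" by (auto simp: S_def)
  have p: "integrable M p" "(\<integral>x. p x \<partial>M) = 1"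
    unfolding p_def using iS mS by (simp_all add: d_eq S_sub)
  have pc: "c \<le> p x" for x unfolding p_def using d_pos mS by simp
  have ig: "integrable M ?g" using integrable_mult_kernel[OF integrable_const[of 1] B] by simp
  have iSg: "integrable M (\<lambda>x. indicator S x * ?g x)" by (rule integrable_mult_kernel[OF iS B])
  have "(\<integral>x. indicator S x * ?g x \<partial>M) \<le> (\<integral>x. indicator S x * (?g x' + \<delta>) \<partial>M)"
  proof (rule integral_mono)
    show "indicator S x * ?g x \<le> indicator S x * (?g x' + \<delta>)" for x
      by (auto simp: S_def indicator_def)
  qed (use iSg iS in auto)
  also have "\<dots> = measure M S * (?g x' + \<delta>)" using iS by (simp add: S_sub)
  finally have Sg: "(\<integral>x. indicator S x * ?g x \<partial>M) \<le> measure M S * (?g x' + \<delta>)" .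
  have "(\<integral>x. p x * ?g x \<partial>M)
      = (\<integral>x. c * ?g x + d / measure M S * (indicator S x * ?g x) \<partial>M)"
    by (rule Bochner_Integration.integral_cong) (auto simp: p_def algebra_simps)
  also have "\<dots> = c * (\<integral>x. ?g x \<partial>M) + d / measure M S * (\<integral>x. indicator S x * ?g x \<partial>M)"
    using ig iSg by simp
  also have "\<dots> \<le> c * (\<integral>x. ?g x \<partial>M) + d / measure M S * (measure M S * (?g x' + \<delta>))"
    using Sg d_pos mS by (intro add_left_mono mult_left_mono) auto
  also have "\<dots> = c * (\<integral>x. ?g x \<partial>M) + d * ?g x' + d * \<delta>"
    using mS by (simp add: algebra_simps)
  finally have "exp \<epsilon> * (\<integral>x. p x * ?g x \<partial>M) \<le> exp \<epsilon> * (c * (\<integral>x. ?g x \<partial>M) + d * ?g x' + d * \<delta>)"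
    by (intro mult_left_mono) auto
  also have "\<dots> = exp \<epsilon> * (c * (\<integral>x. ?g x \<partial>M) + d * ?g x') + e"
    using d_pos by (simp add: \<delta>_def algebra_simps)
  finally show "?g x \<le> exp \<epsilon> * (c * (\<integral>x. ?g x \<partial>M) + d * ?g x') + e"
    using kernel_le[OF p(1) pc p(2) x B] by linarith
qed

text \<open>The comparison of two kernel values is used for \<open>B\<close> and, with the points
  exchanged, for its complement. In the sum the unknown integral \<open>?I\<close> cancels, leaving
  a linear inequality for the difference of the two values.\<close>

lemma kernel_oscillation:
  assumes x: "x \<in> space M" and x': "x' \<in> space M" and B: "B \<in> sets Y"
  shows "measure (K x) B - measure (K x') B \<le> eta_TV \<epsilon> d"
proof -
  let ?g = "\<lambda>x. measure (K x) B"
  let ?I = "\<integral>x. ?g x \<partial>M"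
  let ?B' = "space Y - B"
  have compl: "measure (K z) ?B' = 1 - ?g z" if "z \<in> space M" for z
    using prob_space.prob_compl[OF kernel_prob(1)[OF that], of B] kernel_prob(2)[OF that] B
      sets_eq_imp_space_eq[OF kernel_prob(2)[OF that]] by simp
  have ig: "integrable M ?g" using integrable_mult_kernel[OF integrable_const[of 1] B] by simp
  have "(\<integral>x. measure (K x) ?B' \<partial>M) = (\<integral>x. 1 - ?g x \<partial>M)"
    by (rule Bochner_Integration.integral_cong) (auto simp: compl)
  also have "\<dots> = measure M (space M) - ?I" using ig by simp
  finally have I': "(\<integral>x. measure (K x) ?B' \<partial>M) = measure M (space M) - ?I" .
  have "?g x \<le> exp \<epsilon> * (c * ?I + d * ?g x')" by (rule kernel_le_kernel[OF x x' B])
  moreover have "1 - ?g x' \<le> exp \<epsilon> * (c * (measure M (space M) - ?I) + d * (1 - ?g x))"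
    using kernel_le_kernel[OF x' x, of ?B'] B by (simp add: I' compl x x')
  ultimately have "?g x + (1 - ?g x')
      \<le> exp \<epsilon> * (c * measure M (space M) + d - d * (?g x - ?g x'))"
    by (simp add: algebra_simps)
  \<comment> \<open>The total mass of a prior enters here:
    \<open>c * measure M (space M) + d = 1\<close>.\<close>
  also have "\<dots> = exp \<epsilon> * (1 - d * (?g x - ?g x'))" by (simp add: d_eq)
  finally have "(?g x - ?g x') * (1 + exp \<epsilon> * d) \<le> exp \<epsilon> - 1" by (simp add: algebra_simps)
  then have "?g x - ?g x' \<le> (exp \<epsilon> - 1) / (1 + exp \<epsilon> * d)"
    using d_pos by (simp add: pos_le_divide_eq add_pos_pos)
  moreover have "?g x - ?g x' \<le> 1"
    using prob_space.prob_le_1[OF kernel_prob(1)[OF x], of B] measure_nonneg[of "K x'" B] by linarith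
  ultimately show ?thesis by (simp add: eta_TV_def)
qed

text \<open>For each \<open>B\<close>, the function to integrate against the two priors is the
  kernel probability of \<open>B\<close>, whose oscillation is at most
  \<open>eta_TV \<epsilon> d\<close>.\<close>

lemma tv_dist_bind_le:
  assumes P: "P \<in> prob_measures_ge M c" and Q: "Q \<in> prob_measures_ge M c"
  shows "tv_dist (P \<bind> K) (Q \<bind> K) \<le> eta_TV \<epsilon> d * tv_dist P Q"
proof (rule tv_dist_least)
  \<comment> \<open>The one-sided bound is proved for arbitrary priors so that exchanging them gives
    the absolute value.\<close>
  have le: "measure (P \<bind> K) B - measure (Q \<bind> K) B \<le> eta_TV \<epsilon> d * tv_dist P Q"
    if P: "P \<in> prob_measures_ge M c" and Q: "Q \<in> prob_measures_ge M c" and B: "B \<in> sets Y"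
    for P Q B
  proof -
    obtain p where p: "integrable M p" "\<And>x. c \<le> p x" "(\<integral>x. p x \<partial>M) = 1"
        "P = density M p" "prob_space P"
      using prob_measures_geE[OF finite_measure_axioms _ P] c_pos by (metis less_imp_le)
    obtain q where q: "integrable M q" "\<And>x. c \<le> q x" "(\<integral>x. q x \<partial>M) = 1"
        "Q = density M q" "prob_space Q"
      using prob_measures_geE[OF finite_measure_axioms _ Q] c_pos by (metis less_imp_le)
    have p0: "0 \<le> p x" and q0: "0 \<le> q x" for x using p(2)[of x] q(2)[of x] c_pos by auto
    have "(\<integral>x. p x * measure (K x) B \<partial>M) - (\<integral>x. q x * measure (K x) B \<partial>M)
        \<le> eta_TV \<epsilon> d * tv_dist (density M p) (density M q)"
      using p q p0 q0 kernel_measurable[OF B] kernel_oscillation[OF _ _ B]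
      by (intro integral_diff_le_oscillation_tv_dist) auto
    then show ?thesis
      using measure_density_bind[OF p(1) p0 _ B] measure_density_bind[OF q(1) q0 _ B] p q by simp
  qed
  fix B assume "B \<in> sets (P \<bind> K)"
  then have B: "B \<in> sets Y"
    using P bind_prob(2)[of P] by (auto simp: prob_measures_ge_def ac_prob_measures_def)
  have "tv_dist P Q = tv_dist Q P"
    using P Q by (intro tv_dist_commute) (simp add: prob_measures_ge_def ac_prob_measures_def)
  then show "\<bar>measure (P \<bind> K) B - measure (Q \<bind> K) B\<bar> \<le> eta_TV \<epsilon> d * tv_dist P Q"
    using le[OF P Q B] le[OF Q P B] by (simp add: abs_le_iff)
qed

end

section \<open>Divergence bound from density ratio and contraction\<close>

theorem theorem5:
  fixes X \<mu>X P Q :: "'a measure" and Y \<mu>Y :: "'b measure" and K :: "'a \<Rightarrow> 'b measure"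
    and f :: "real \<Rightarrow> real" and \<epsilon> c d :: real
  assumes "standard_borel X" and "standard_borel Y"
    and "sets \<mu>X = sets X" and "finite_measure \<mu>X" and "emeasure \<mu>X (space \<mu>X) \<noteq> 0"
    and "sets \<mu>Y = sets Y" and "sigma_finite_measure \<mu>Y"
    and "K \<in> X \<rightarrow>\<^sub>M prob_algebra Y"
    and "dominated_kernel X \<mu>Y K"
    and "sup_inf_essential \<mu>X Y K"
    and "convex_on {0<..} f" and "f 1 = 0"
    and "\<epsilon> > 0" and "0 < c" and "c < inverse (measure \<mu>X (space \<mu>X))"
    and "d = 1 - c * measure \<mu>X (space \<mu>X)"
    and "satisfies_PML \<epsilon> (prob_measures_ge \<mu>X c) X Y K"
    and "P \<in> prob_measures_ge \<mu>X c" and "Q \<in> prob_measures_ge \<mu>X c"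
  shows "f_divergence f (P \<bind> K) (Q \<bind> K) \<le>
    ereal (eta_TV \<epsilon> d / (exp \<epsilon> * d) *
      (f (exp \<epsilon> * d + 1) + (exp \<epsilon> * d + 1) * f (inverse (exp \<epsilon> * d + 1))) *
      tv_dist P Q)"
proof -
  interpret \<mu>X: finite_measure \<mu>X by fact
  have "0 < measure \<mu>X (space \<mu>X)"
    using assms(5) by (simp add: \<mu>X.emeasure_eq_measure zero_less_measure_iff)
  then have d: "0 < d" using assms(15,16) by (simp add: field_simps)
  have sp: "space X = space \<mu>X" using sets_eq_imp_space_eq[OF assms(3)] by simp
  interpret PML_kernel \<mu>X Y K \<epsilon> c d
  proof
    show "K \<in> \<mu>X \<rightarrow>\<^sub>M prob_algebra Y"
      using assms(8) measurable_cong_sets[OF assms(3) refl] by blast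
    show "satisfies_PML \<epsilon> (prob_measures_ge \<mu>X c) \<mu>X Y K"
      using assms(17) by (simp add: satisfies_PML_def sp)
  qed (use assms d in auto)
  \<comment> \<open>With this choice \<open>A - 1\<close> is the denominator
    \<open>exp \<epsilon> * d\<close> of the claim, and \<open>A\<close> is the ratio bound for the
    outputs in both directions.\<close>
  define A where "A = exp \<epsilon> * d + 1"
  have A: "1 < A" using d by (simp add: A_def)
  have PQ: "prob_space P" "sets P = sets \<mu>X" "prob_space Q" "sets Q = sets \<mu>X"
    using assms(18,19) by (auto simp: prob_measures_ge_def ac_prob_measures_def)
  note bP = bind_prob[OF PQ(1,2)] and bQ = bind_prob[OF PQ(3,4)]
  let ?C = "(f A + A * f (1 / A)) / (A - 1)"
  have "f_divergence f (P \<bind> K) (Q \<bind> K) \<le> ereal (?C * tv_dist (P \<bind> K) (Q \<bind> K))"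
    using bP bQ assms(11,12) A bind_ratio_le[OF assms(18,19)] bind_ratio_le[OF assms(19,18)]
    by (intro f_divergence_le_tv_dist) (auto simp: A_def)
  \<comment> \<open>Contraction may be inserted because the constant \<open>?C\<close> is
    nonnegative.\<close>
  also have "\<dots> \<le> ereal (?C * (eta_TV \<epsilon> d * tv_dist P Q))"
    using tv_dist_bind_le[OF assms(18,19)] convex_chord_slopes_nonneg[OF assms(11,12), of A] A
    by (auto intro!: mult_left_mono divide_right_mono)
  also have "?C * (eta_TV \<epsilon> d * tv_dist P Q)
      = eta_TV \<epsilon> d / (exp \<epsilon> * d) * (f A + A * f (inverse A)) * tv_dist P Q"
    by (simp add: A_def inverse_eq_divide)
  finally show ?thesis by (simp only: A_def)
qed

end
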